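(* Let $A(x)$, $x \in D_0$, be a holomorphic family of bounded operators on a separable Hilbert space $\mathbb{H}$ with domain $D_0$ in the complex plane, $0\in D_0$, such that $A(x)$ is self-adjoint for each $x\in D_0$. Let $(a,b)$ be a gap in $\sigma_e(A(0))$ which contains no discrete spectral value of $A(0)$. Then for all small enough $\varepsilon>0$ there exists $\delta>0$ such that $(a+\varepsilon,b-\varepsilon)$ is a gap in the essential spectrum of $A(x)$ for every $x \in D_0$ with $|x|<\delta$.
   Context: A family of bounded operators $A(x)$, $x\in D_0\subseteq\mathbb{C}$, is called holomorphic (analytic) if for each $y\in D_0$ the limit $\lim_{x\to y}\frac{\|A(x)-A(y)\|}{|x-y|}$ exists and is finite. $\sigma_e$ denotes the essential spectrum; discrete spectral values are the points of the spectrum that are isolated eigenvalues of finite multiplicity. A gap in $\sigma_e(T)$, for $T$ bounded self-adjoint, is a nonempty open interval lying between the lower and upper bounds (infimum and supremum) of $\sigma_e(T)$ and containing no point of $\sigma_e(T)$. *)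

theory Defs
  imports "HOL-Analysis.Analysis"
begin

text \<open>
  Complex Hilbert spaces, built on top of the real inner product spaces of the library: the real
  inner product is the real part of the complex one, so that the norm is
  \<open>norm x = sqrt (Re (cinner x x))\<close>. The form \<open>cinner\<close> is linear in its first argument. Positive
  definiteness is inherited from \<^class>\<open>real_inner\<close>.
\<close>

class complex_inner = real_inner +
  fixes scaleC :: "complex \<Rightarrow> 'a \<Rightarrow> 'a" (infixr "*\<^sub>C" 75)
    and cinner :: "'a \<Rightarrow> 'a \<Rightarrow> complex"
  assumes scaleC_add_right: "c *\<^sub>C (x + y) = c *\<^sub>C x + c *\<^sub>C y"
    and scaleC_add_left: "(c + d) *\<^sub>C x = c *\<^sub>C x + d *\<^sub>C x"
    and scaleC_scaleC: "c *\<^sub>C d *\<^sub>C x = (c * d) *\<^sub>C x"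
    and scaleR_scaleC: "r *\<^sub>R x = complex_of_real r *\<^sub>C x"
    and cinner_commute: "cinner x y = cnj (cinner y x)"
    and cinner_add_left: "cinner (x + y) z = cinner x z + cinner y z"
    and cinner_scaleC_left: "cinner (c *\<^sub>C x) y = c * cinner x y"
    and inner_cinner: "inner x y = Re (cinner x y)"

class chilbert_space = complex_inner + complete_space

instance chilbert_space \<subseteq> banach ..

lemma vector_space_scaleC: "vector_space (scaleC :: complex \<Rightarrow> 'a \<Rightarrow> 'a::complex_inner)"
proof
  fix x :: 'a
  show "1 *\<^sub>C x = x"
    using scaleR_scaleC[of 1 x] by simp
qed (simp_all add: scaleC_add_right scaleC_add_left scaleC_scaleC)

text \<open>
  Bounded operators are complex linear elements of the library type of bounded real linear maps;
  its norm is the operator norm.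
\<close>

definition complex_linear :: "('a::complex_inner \<Rightarrow>\<^sub>L 'a) \<Rightarrow> bool" where
  "complex_linear T \<longleftrightarrow> (\<forall>c v. T (c *\<^sub>C v) = c *\<^sub>C T v)"

definition self_adjoint :: "('a::complex_inner \<Rightarrow>\<^sub>L 'a) \<Rightarrow> bool" where
  "self_adjoint T \<longleftrightarrow> (\<forall>u v. cinner (T u) v = cinner u (T v))"

definition holomorphic_family :: "complex set \<Rightarrow> (complex \<Rightarrow> 'a::complex_inner \<Rightarrow>\<^sub>L 'a) \<Rightarrow> bool" where
  "holomorphic_family D A \<longleftrightarrow>
     (\<forall>y\<in>D. \<exists>L::real. ((\<lambda>x. norm (A x - A y) / norm (x - y)) \<longlongrightarrow> L) (at y within D))"

definition op_spectrum :: "('a::complex_inner \<Rightarrow>\<^sub>L 'a) \<Rightarrow> complex set" where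
  "op_spectrum T = {z. \<not> (\<exists>S::'a \<Rightarrow>\<^sub>L 'a. complex_linear S \<and>
     (\<forall>v. S (T v - z *\<^sub>C v) = v) \<and> (\<forall>v. T (S v) - z *\<^sub>C S v = v))}"

definition eigenspace :: "('a::complex_inner \<Rightarrow>\<^sub>L 'a) \<Rightarrow> complex \<Rightarrow> 'a set" where
  "eigenspace T z = {v. T v = z *\<^sub>C v}"

text \<open>
  Multiplicity is the complex dimension of the eigenspace. The notions below are meant for
  self-adjoint operators, where it agrees with the algebraic multiplicity.
\<close>

definition discrete_spectrum :: "('a::complex_inner \<Rightarrow>\<^sub>L 'a) \<Rightarrow> complex set" where
  "discrete_spectrum T = {z. z isolated_in op_spectrum T \<and> (\<exists>v\<in>eigenspace T z. v \<noteq> 0) \<and>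
     (\<exists>B. finite B \<and> eigenspace T z = module.span scaleC B)}"

definition essential_spectrum :: "('a::complex_inner \<Rightarrow>\<^sub>L 'a) \<Rightarrow> complex set" where
  "essential_spectrum T = op_spectrum T - discrete_spectrum T"

text \<open>
  \<open>(a,b)\<close> is a gap in the essential spectrum of the self-adjoint operator \<open>T\<close>. That spectrum is
  a bounded set of real numbers, and \<open>E\<close> is the same set at type \<^typ>\<open>real\<close>. Nonemptiness of \<open>E\<close>
  is required because the infimum and supremum of the empty set are unspecified reals.
\<close>

definition essential_gap :: "('a::complex_inner \<Rightarrow>\<^sub>L 'a) \<Rightarrow> real \<Rightarrow> real \<Rightarrow> bool" where
  "essential_gap T a b \<longleftrightarrow> (let E = {r. complex_of_real r \<in> essential_spectrum T} in
     a < b \<and> E \<noteq> {} \<and> Inf E \<le> a \<and> b \<le> Sup E \<and> {a<..<b} \<inter> E = {})"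

end

theory Submission
  imports Defs
begin

text \<open>The essential spectrum of a bounded self-adjoint operator moves by at most the norm of the
  perturbation: if \<open>norm (S - T) < d\<close>, every point of the essential spectrum of \<open>S\<close> has one of
  \<open>T\<close> within \<open>d\<close> (\<open>essential_spectrum_near\<close>). Applied in both directions to \<open>A 0\<close> and \<open>A x\<close>, whose
  distance tends to \<open>0\<close> with \<open>x\<close>, this keeps the shrunken interval free of essential spectrum and
  keeps essential spectrum on both sides of it.

  The stability rests on a description of the essential spectrum by lower bounds. A real
  number \<open>r\<close> is outside the essential spectrum of \<open>T\<close> exactly when \<open>T - r\<close> is bounded below on the orthogonal complement of some finite
  set (\<open>not_essential_if_bounded_below\<close>, \<open>bounded_below_if_not_essential\<close>). This condition is
  insensitive to perturbations that are small compared with the lower bound. So what remains is to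
  find, when \<open>T - r\<close> has no lower bound \<open>d\<close> on any such complement, a point \<open>q\<close> within \<open>d\<close> of \<open>r\<close> where
  \<open>T - q\<close> has no positive lower bound at all (\<open>approximate_eigenvalue_near\<close>). It is found as
  \<open>r \<plusminus> sqrt m\<close>, where \<open>m\<close> is the bottom, modulo finite codimension, of the quadratic form of
  \<open>(T - r)\<^sup>2\<close>: the bottom of a form is always an approximate eigenvalue, and \<open>(T - r)\<^sup>2 - m\<close> factors.

  The same estimate with the whole space as the only test space says that the distance from \<open>r\<close> to the
  spectrum bounds \<open>T - r\<close> below. This is used to see that at an isolated spectral point the operator
  is bounded below on the complement of the eigenspace.\<close>

section \<open>Symmetric maps and lower bounds\<close>

text \<open>Everything up to the spectrum itself is done in a real inner product space: a complex
  self-adjoint operator is symmetric for the real part of the inner product.\<close>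

definition symmetric_map :: "('a::real_inner \<Rightarrow> 'a) \<Rightarrow> bool" where
  "symmetric_map f \<longleftrightarrow> bounded_linear f \<and> (\<forall>u v. inner (f u) v = inner u (f v))"

definition bounded_below_on :: "'a::real_normed_vector set \<Rightarrow> ('a \<Rightarrow> 'b::real_normed_vector) \<Rightarrow> bool" where
  "bounded_below_on M f \<longleftrightarrow> (\<exists>c>0. \<forall>v\<in>M. c * norm v \<le> norm (f v))"

text \<open>A test family is the range of subspaces on which an operator may be asked to be bounded
  below. The two families that matter are the whole space alone, which detects the spectrum of a
  self-adjoint operator, and the orthogonal complements of finite sets, which detect its essential
  spectrum. Stability under intersections and under preimages by symmetric maps lets one argument
  serve for both.\<close>

definition test_family :: "'a::real_inner set set \<Rightarrow> bool" where
  "test_family \<M> \<longleftrightarrow> \<M> \<noteq> {} \<and> (\<forall>M\<in>\<M>. subspace M) \<and> (\<forall>M\<in>\<M>. \<forall>N\<in>\<M>. M \<inter> N \<in> \<M>) \<and>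
     (\<forall>f. symmetric_map f \<longrightarrow> (\<forall>M\<in>\<M>. f -` M \<in> \<M>))"

lemma test_family_UNIV: "test_family {UNIV}"
  by (simp add: test_family_def)

lemma test_family_orthogonal_comp: "test_family {orthogonal_comp F | F. finite F}"
proof -
  have "orthogonal_comp F \<inter> orthogonal_comp G = orthogonal_comp (F \<union> G)" for F G :: "'a set"
    by (auto simp: orthogonal_comp_def)
  moreover have "f -` orthogonal_comp F = orthogonal_comp (f ` F)" if "symmetric_map f"
    for f and F :: "'a set"
    using that by (auto simp: orthogonal_comp_def orthogonal_def symmetric_map_def)
  ultimately show ?thesis
    unfolding test_family_def by (auto simp: subspace_orthogonal_comp) blast+
qed

lemma symmetric_map_add_scaleR:
  assumes "symmetric_map f"
  shows "symmetric_map (\<lambda>v. f v + r *\<^sub>R v)"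
  using assms unfolding symmetric_map_def
  by (auto intro!: bounded_linear_add bounded_linear_scaleR_right simp: inner_add_left inner_add_right)

lemma symmetric_map_comp_self:
  assumes "symmetric_map f"
  shows "symmetric_map (\<lambda>v. f (f v))"
  using assms unfolding symmetric_map_def by (auto intro: bounded_linear_compose)

section \<open>Approximate eigenvalues of symmetric maps\<close>

text \<open>The bottom of a symmetric quadratic form is an approximate eigenvalue, here normalised to be
  \<open>0\<close>. Shifting \<open>P\<close> by a small \<open>\<eta>\<close> makes the form of \<open>Q = P + \<eta>\<close> nonnegative on a member \<open>M0\<close> of the
  family, and there the Cauchy-Schwarz inequality for this semidefinite form bounds the norm of \<open>Q v\<close>
  by a multiple of the square root of \<open>inner (Q v) v\<close>. It is applied to the pair \<open>v\<close>, \<open>Q v\<close>, so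
  \<open>Q v\<close> must lie in \<open>M0\<close> too; this is why the family has to be stable under preimages.\<close>

lemma form_bottom_not_bounded_below:
  fixes P :: "'a::real_inner \<Rightarrow> 'a"
  assumes fam: "test_family \<M>" and P: "symmetric_map P"
    and lower: "\<And>\<eta>. \<eta> > 0 \<Longrightarrow> \<exists>M\<in>\<M>. \<forall>v\<in>M. - \<eta> * (norm v)\<^sup>2 \<le> inner (P v) v"
    and upper: "\<And>\<eta> M. \<eta> > 0 \<Longrightarrow> M \<in> \<M> \<Longrightarrow> \<exists>v\<in>M. inner (P v) v < \<eta> * (norm v)\<^sup>2"
    and M: "M \<in> \<M>"
  shows "\<not> bounded_below_on M P"
proof
  assume "bounded_below_on M P"
  then obtain c where c: "c > 0" "\<And>v. v \<in> M \<Longrightarrow> c * norm v \<le> norm (P v)"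
    unfolding bounded_below_on_def by auto
  have "bounded_linear P" using P by (simp add: symmetric_map_def)
  then obtain B where B: "B > 0" "\<And>v. norm (P v) \<le> norm v * B"
    using bounded_linear.pos_bounded by blast
  define C where "C = B + 1"
  \<comment> \<open>The first bound makes \<open>C\<close> a bound for the shifted operator \<open>Q\<close>; the other two let the shift and
    \<open>Q v\<close> use up at most half of the lower bound \<open>c\<close> each.\<close>
  define \<eta> where "\<eta> = min (min 1 (c / 2)) (c\<^sup>2 / (8 * C))"
  have C: "C > 0" using B by (simp add: C_def)
  have \<eta>: "\<eta> > 0" "\<eta> \<le> 1" "\<eta> \<le> c / 2" "\<eta> * (8 * C) \<le> c\<^sup>2"
  proof -
    show "\<eta> > 0" using c C by (simp add: \<eta>_def)
    have "\<eta> \<le> c\<^sup>2 / (8 * C)" by (simp add: \<eta>_def)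
    then show "\<eta> * (8 * C) \<le> c\<^sup>2" using C by (simp add: pos_le_divide_eq)
  qed (auto simp: \<eta>_def)
  define Q where "Q v = P v + \<eta> *\<^sub>R v" for v
  have Qsym: "symmetric_map Q" unfolding Q_def by (rule symmetric_map_add_scaleR[OF P])
  then have Qlin: "linear Q" and Qinner: "\<And>u v. inner (Q u) v = inner u (Q v)"
    by (auto simp: symmetric_map_def bounded_linear.linear)
  have QC: "norm (Q v) \<le> C * norm v" for v
  proof -
    have "norm (Q v) \<le> norm (P v) + \<eta> * norm v"
      unfolding Q_def using norm_triangle_ineq[of "P v" "\<eta> *\<^sub>R v"] \<eta> by simp
    also have "\<dots> \<le> norm v * B + 1 * norm v"
      using B \<eta> by (intro add_mono mult_right_mono) auto
    finally show ?thesis by (simp add: C_def algebra_simps)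
  qed
  obtain M0 where M0: "M0 \<in> \<M>" "\<And>v. v \<in> M0 \<Longrightarrow> - \<eta> * (norm v)\<^sup>2 \<le> inner (P v) v"
    using lower[OF \<eta>(1)] by auto
  have Qpos: "0 \<le> inner (Q v) v" if "v \<in> M0" for v
    using M0(2)[OF that] by (simp add: Q_def inner_add_left power2_norm_eq_inner)
  have "M \<inter> M0 \<inter> Q -` M0 \<in> \<M>"
    using fam Qsym M M0(1) unfolding test_family_def by blast
  from upper[OF \<eta>(1) this] obtain v where v: "v \<in> M" "v \<in> M0" "Q v \<in> M0"
    and "inner (P v) v < \<eta> * (norm v)\<^sup>2" by auto
  then have Qv: "inner (Q v) v < 2 * \<eta> * (norm v)\<^sup>2"
    by (simp add: Q_def inner_add_left power2_norm_eq_inner)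
  then have v0: "norm v > 0" by (cases "v = 0") (auto simp: linear_0[OF Qlin])
  \<comment> \<open>The value of \<open>t\<close> that minimises the upper bound found below for the form at \<open>v - t Q v\<close>.\<close>
  define t where "t = 1 / C"
  have "subspace M0" using fam M0 by (auto simp: test_family_def)
  then have "v - t *\<^sub>R Q v \<in> M0" using v by (simp add: subspace_diff subspace_scale)
  then have "0 \<le> inner (Q (v - t *\<^sub>R Q v)) (v - t *\<^sub>R Q v)" by (rule Qpos)
  also have "\<dots> = inner (Q v) v - 2 * t * (norm (Q v))\<^sup>2 + t\<^sup>2 * inner (Q (Q v)) (Q v)"
    using Qinner[of "Q v" v] unfolding linear_diff[OF Qlin] linear_scale[OF Qlin]
    by (simp only: inner_diff_left inner_diff_right inner_scaleR_left inner_scaleR_right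
        power2_norm_eq_inner) (simp add: power2_eq_square right_diff_distrib)
  also have "\<dots> \<le> inner (Q v) v - 2 * t * (norm (Q v))\<^sup>2 + t\<^sup>2 * (C * (norm (Q v))\<^sup>2)"
  proof -
    have "inner (Q (Q v)) (Q v) \<le> norm (Q (Q v)) * norm (Q v)" by (rule norm_cauchy_schwarz)
    also have "\<dots> \<le> C * norm (Q v) * norm (Q v)" by (intro mult_right_mono QC) auto
    finally show ?thesis by (intro add_left_mono mult_left_mono) (auto simp: power2_eq_square)
  qed
  also have "\<dots> = inner (Q v) v - (norm (Q v))\<^sup>2 / C"
    using C by (simp add: t_def power2_eq_square field_simps)
  finally have "(norm (Q v))\<^sup>2 \<le> inner (Q v) v * C" using C by (simp add: field_simps)
  also have "\<dots> < 2 * \<eta> * (norm v)\<^sup>2 * C" using Qv C by simp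
  also have "\<dots> = (\<eta> * (8 * C)) * (norm v)\<^sup>2 / 4" by simp
  also have "\<dots> \<le> c\<^sup>2 * (norm v)\<^sup>2 / 4" using \<eta>(4) by (intro divide_right_mono mult_right_mono) auto
  also have "\<dots> = (c / 2 * norm v)\<^sup>2" by (simp add: power2_eq_square)
  finally have "norm (Q v) < c / 2 * norm v"
    by (rule power_less_imp_less_base) (use c(1) in simp)
  moreover have "norm (P v) \<le> norm (Q v) + \<eta> * norm v"
    using norm_triangle_ineq4[of "Q v" "\<eta> *\<^sub>R v"] \<eta>(1) by (simp add: Q_def)
  moreover have "\<eta> * norm v \<le> c / 2 * norm v" using \<eta>(3) v0 by simp
  ultimately show False using c(2)[OF v(1)] by simp
qed

text \<open>Used in the contrapositive: if a product of two commuting shifts of an operator fails to be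
  bounded below, so does one of the factors.\<close>

lemma bounded_below_on_comp:
  assumes fam: "test_family \<M>" and g: "symmetric_map g"
    and "\<exists>M\<in>\<M>. bounded_below_on M f" and "\<exists>M\<in>\<M>. bounded_below_on M g"
  shows "\<exists>M\<in>\<M>. bounded_below_on M (\<lambda>v. f (g v))"
proof -
  obtain M N c d where M: "M \<in> \<M>" and N: "N \<in> \<M>" and c: "c > 0" "\<And>v. v \<in> M \<Longrightarrow> c * norm v \<le> norm (f v)"
    and d: "d > 0" "\<And>v. v \<in> N \<Longrightarrow> d * norm v \<le> norm (g v)"
    using assms(3,4) unfolding bounded_below_on_def by blast
  have "N \<inter> g -` M \<in> \<M>" using fam g M N unfolding test_family_def by blast
  moreover have "c * d * norm v \<le> norm (f (g v))" if "v \<in> N \<inter> g -` M" for v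
  proof -
    have "c * (d * norm v) \<le> c * norm (g v)" using c d that by (intro mult_left_mono) auto
    also have "\<dots> \<le> norm (f (g v))" using c that by auto
    finally show ?thesis by simp
  qed
  ultimately show ?thesis unfolding bounded_below_on_def using c(1) d(1)
    by (intro bexI[of _ "N \<inter> g -` M"] exI[of _ "c * d"]) auto
qed

text \<open>The distance estimate behind the stability of the spectrum. With \<open>K = T - \<nu>\<close>, let \<open>m\<close> be the
  bottom, relative to the family, of the form of \<open>K\<^sup>2\<close>. The hypothesis gives \<open>m \<le> d\<^sup>2\<close>, and
  \<open>K\<^sup>2 - m\<close> is bounded below on no member of the family. Since
  \<open>K\<^sup>2 - m = (K - sqrt m) (K + sqrt m)\<close>, one of \<open>\<nu> \<plusminus> sqrt m\<close> is the required \<open>\<mu>\<close>.\<close>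

lemma approximate_eigenvalue_near:
  fixes T :: "'a::real_inner \<Rightarrow> 'a"
  assumes fam: "test_family \<M>" and T: "symmetric_map T" and d: "d \<ge> 0"
    and small: "\<And>M. M \<in> \<M> \<Longrightarrow> \<exists>v\<in>M. norm (T v - \<nu> *\<^sub>R v) < d * norm v"
  shows "\<exists>\<mu>. \<bar>\<mu> - \<nu>\<bar> \<le> d \<and> (\<forall>M\<in>\<M>. \<not> bounded_below_on M (\<lambda>v. T v - \<mu> *\<^sub>R v))"
proof -
  have sym: "symmetric_map (\<lambda>v. T v - r *\<^sub>R v)" for r
    using symmetric_map_add_scaleR[OF T, of "-r"] by simp
  have lin: "linear T" using T by (auto simp: symmetric_map_def bounded_linear.linear)
  define K where "K v = T v - \<nu> *\<^sub>R v" for v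
  have Ksym: "symmetric_map K" unfolding K_def by (rule sym)
  then have Kinn: "\<And>u v. inner (K u) v = inner u (K v)" by (auto simp: symmetric_map_def)
  define X where "X = {m. \<exists>M\<in>\<M>. \<forall>v\<in>M. m * (norm v)\<^sup>2 \<le> (norm (K v))\<^sup>2}"
  define m where "m = Sup X"
  have X0: "0 \<in> X" using fam by (auto simp: X_def test_family_def)
  have Xub: "x \<le> d\<^sup>2" if "x \<in> X" for x
  proof (rule ccontr)
    assume "\<not> x \<le> d\<^sup>2"
    obtain M where M: "M \<in> \<M>" "\<And>v. v \<in> M \<Longrightarrow> x * (norm v)\<^sup>2 \<le> (norm (K v))\<^sup>2"
      using \<open>x \<in> X\<close> by (auto simp: X_def)
    obtain v where v: "v \<in> M" "norm (K v) < d * norm v"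
      using small[OF M(1)] by (auto simp: K_def)
    have "(norm (K v))\<^sup>2 < (d * norm v)\<^sup>2" using v(2) by (intro power_strict_mono) auto
    also have "\<dots> = d\<^sup>2 * (norm v)\<^sup>2" by (simp add: power_mult_distrib)
    also have "\<dots> \<le> x * (norm v)\<^sup>2" using \<open>\<not> x \<le> d\<^sup>2\<close> by (intro mult_right_mono) auto
    finally show False using M(2)[OF v(1)] by simp
  qed
  have bdd: "bdd_above X" using Xub by (auto simp: bdd_above_def)
  have m0: "0 \<le> m" unfolding m_def using X0 bdd by (rule cSup_upper)
  have md: "m \<le> d\<^sup>2" unfolding m_def using X0 Xub by (intro cSup_least) auto
  define P where "P v = K (K v) - m *\<^sub>R v" for v
  have Psym: "symmetric_map P"
    using symmetric_map_add_scaleR[OF symmetric_map_comp_self[OF Ksym], of "-m"] by (simp add: P_def[abs_def])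
  have Pform: "inner (P v) v = (norm (K v))\<^sup>2 - m * (norm v)\<^sup>2" for v
    by (simp add: P_def inner_diff_left Kinn power2_norm_eq_inner)
  have notP: "\<not> bounded_below_on M P" if "M \<in> \<M>" for M
  proof (rule form_bottom_not_bounded_below[OF fam Psym _ _ that])
    fix \<eta> :: real assume \<eta>: "\<eta> > 0"
    then obtain x where "x \<in> X" "m - \<eta> < x"
      using less_cSup_iff[of X "m - \<eta>"] X0 bdd by (auto simp: m_def)
    then obtain M where M: "M \<in> \<M>" "\<And>v. v \<in> M \<Longrightarrow> x * (norm v)\<^sup>2 \<le> (norm (K v))\<^sup>2"
      by (auto simp: X_def)
    have "- \<eta> * (norm v)\<^sup>2 \<le> inner (P v) v" if "v \<in> M" for v
    proof -
      have "(m - \<eta>) * (norm v)\<^sup>2 \<le> x * (norm v)\<^sup>2" using \<open>m - \<eta> < x\<close> by (intro mult_right_mono) auto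
      then show ?thesis using M(2)[OF that] by (simp add: Pform algebra_simps)
    qed
    then show "\<exists>M\<in>\<M>. \<forall>v\<in>M. - \<eta> * (norm v)\<^sup>2 \<le> inner (P v) v" using M(1) by blast
    fix N assume "N \<in> \<M>"
    have "m + \<eta> \<notin> X" using cSup_upper[OF _ bdd] \<eta> by (force simp: m_def)
    then show "\<exists>v\<in>N. inner (P v) v < \<eta> * (norm v)\<^sup>2"
      using \<open>N \<in> \<M>\<close> by (auto simp: X_def Pform algebra_simps not_le)
  qed
  define s where "s = sqrt m"
  have s: "s * s = m" "0 \<le> s" "s \<le> d"
    using m0 md d by (auto simp: s_def real_le_lsqrt)
  have P_factor: "P = (\<lambda>v. T (T v - (\<nu> - s) *\<^sub>R v) - (\<nu> + s) *\<^sub>R (T v - (\<nu> - s) *\<^sub>R v))"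
    unfolding P_def K_def s(1)[symmetric]
    by (simp add: fun_eq_iff linear_diff[OF lin] linear_add[OF lin] linear_scale[OF lin] algebra_simps)
  have "(\<forall>M\<in>\<M>. \<not> bounded_below_on M (\<lambda>v. T v - (\<nu> + s) *\<^sub>R v)) \<or>
        (\<forall>M\<in>\<M>. \<not> bounded_below_on M (\<lambda>v. T v - (\<nu> - s) *\<^sub>R v))"
    using bounded_below_on_comp[OF fam sym[of "\<nu> - s"], of "\<lambda>v. T v - (\<nu> + s) *\<^sub>R v"] notP
    unfolding P_factor by blast
  then show ?thesis
  proof
    assume "\<forall>M\<in>\<M>. \<not> bounded_below_on M (\<lambda>v. T v - (\<nu> + s) *\<^sub>R v)"
    then show ?thesis using s by (intro exI[of _ "\<nu> + s"]) auto
  next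
    assume "\<forall>M\<in>\<M>. \<not> bounded_below_on M (\<lambda>v. T v - (\<nu> - s) *\<^sub>R v)"
    then show ?thesis using s by (intro exI[of _ "\<nu> - s"]) auto
  qed
qed

section \<open>Coercive equations and finite codimension\<close>

text \<open>The Lax-Milgram argument: for small \<open>t\<close> coercivity makes \<open>x \<mapsto> x - t (S x - y)\<close> a contraction
  of \<open>V\<close>, and its fixed point solves the equation.\<close>

lemma coercive_surjective:
  fixes S :: "'a::real_inner \<Rightarrow> 'a"
  assumes V: "subspace V" "complete V" and S: "bounded_linear S" and SV: "S ` V \<subseteq> V"
    and c: "c > 0" and coercive: "\<And>v. v \<in> V \<Longrightarrow> c * (norm v)\<^sup>2 \<le> inner (S v) v"
    and y: "y \<in> V"
  shows "\<exists>x\<in>V. S x = y"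
proof -
  have lin: "linear S" using S by (rule bounded_linear.linear)
  obtain B where B: "B > 0" "\<And>v. norm (S v) \<le> norm v * B"
    using bounded_linear.pos_bounded[OF S] by blast
  \<comment> \<open>Adding \<open>c\<close> ensures \<open>c < C\<close>, so that the contraction constant \<open>k\<close> below is a real square root.\<close>
  define C where "C = B + c"
  have C: "C > 0" "c \<le> C" "c < C" using B c by (auto simp: C_def)
  have SC: "norm (S v) \<le> C * norm v" for v
  proof -
    have "norm v * B \<le> norm v * C" using c by (intro mult_left_mono) (auto simp: C_def)
    then show ?thesis using B(2)[of v] by (simp add: mult.commute)
  qed
  define t where "t = c / C\<^sup>2"
  define k where "k = sqrt (1 - c\<^sup>2 / C\<^sup>2)"
  have t: "t > 0" "t * C\<^sup>2 = c" using c C by (auto simp: t_def)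
  have "c\<^sup>2 < C\<^sup>2" using c C by (intro power_strict_mono) auto
  then have "c\<^sup>2 / C\<^sup>2 < 1" using C by simp
  moreover have "0 < c\<^sup>2 / C\<^sup>2" using c C by simp
  ultimately have k: "0 \<le> k" "k < 1" "k\<^sup>2 = 1 - c\<^sup>2 / C\<^sup>2"
    unfolding k_def by auto
  have contr: "norm (v - t *\<^sub>R S v) \<le> k * norm v" if "v \<in> V" for v
  proof -
    have "(norm (v - t *\<^sub>R S v))\<^sup>2 = (norm v)\<^sup>2 - 2 * t * inner (S v) v + t\<^sup>2 * (norm (S v))\<^sup>2"
      using inner_commute[of v "S v"]
      by (simp only: power2_norm_eq_inner inner_diff_left inner_diff_right
          inner_scaleR_left inner_scaleR_right) (simp add: power2_eq_square right_diff_distrib)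
    also have "\<dots> \<le> (norm v)\<^sup>2 - 2 * t * (c * (norm v)\<^sup>2) + t\<^sup>2 * (C * norm v)\<^sup>2"
      using coercive[OF that] t(1) SC[of v] by (intro add_mono diff_mono mult_left_mono power_mono) auto
    also have "t\<^sup>2 * (C * norm v)\<^sup>2 = t * (t * C\<^sup>2) * (norm v)\<^sup>2"
      by (simp add: power2_eq_square)
    also have "\<dots> = t * c * (norm v)\<^sup>2" unfolding t(2) ..
    also have "(norm v)\<^sup>2 - 2 * t * (c * (norm v)\<^sup>2) + t * c * (norm v)\<^sup>2 = (1 - t * c) * (norm v)\<^sup>2"
      by (simp add: algebra_simps)
    also have "1 - t * c = k\<^sup>2" unfolding k(3) by (simp add: t_def power2_eq_square)
    finally show ?thesis by (rule power2_le_imp_le[OF _ mult_nonneg_nonneg[OF k(1) norm_ge_zero], unfolded power_mult_distrib])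
  qed
  have "\<exists>!x\<in>V. x - t *\<^sub>R (S x - y) = x"
  proof (rule Banach_fix[OF V(2) _ k(1,2)])
    show "V \<noteq> {}" using y by auto
    show "(\<lambda>x. x - t *\<^sub>R (S x - y)) ` V \<subseteq> V"
      using V(1) SV y by (auto intro!: subspace_diff subspace_scale)
    fix u v assume "u \<in> V" "v \<in> V"
    then have "u - v \<in> V" using V(1) by (simp add: subspace_diff)
    moreover have "(u - t *\<^sub>R (S u - y)) - (v - t *\<^sub>R (S v - y)) = (u - v) - t *\<^sub>R S (u - v)"
      by (simp add: linear_diff[OF lin] algebra_simps)
    ultimately show "dist (u - t *\<^sub>R (S u - y)) (v - t *\<^sub>R (S v - y)) \<le> k * dist u v"
      unfolding dist_norm by (simp only: contr)
  qed
  then obtain x where "x \<in> V" "x - t *\<^sub>R (S x - y) = x" by blast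
  then show ?thesis using t(1) by auto
qed

lemma closed_orthogonal_comp: "closed (orthogonal_comp W)"
proof -
  have "orthogonal_comp W = (\<Inter>y\<in>W. {x. inner y x = 0})"
    by (auto simp: orthogonal_comp_def orthogonal_def)
  moreover have "closed {x. inner y x = 0}" for y :: 'a
    by (intro closed_Collect_eq continuous_intros)
  ultimately show ?thesis by (simp add: closed_INT)
qed

text \<open>If \<open>f\<close> is bounded below on the part \<open>W\<close> of \<open>V\<close> orthogonal to \<open>a\<close>, then \<open>f ` W\<close> is complete,
  hence closed. For a vector \<open>u\<close> of \<open>V\<close> outside \<open>W\<close>, injectivity keeps \<open>f u\<close> out of \<open>f ` W\<close>, hence at a
  positive distance from it. This distance controls the coefficient along \<open>u\<close> of a vector of \<open>V\<close>
  by its image.\<close>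

lemma bounded_below_on_drop_constraint:
  fixes f :: "'a::{real_inner,banach} \<Rightarrow> 'b::real_normed_vector"
  assumes f: "bounded_linear f" and V: "subspace V" "closed V"
    and inj: "\<And>v. v \<in> V \<Longrightarrow> f v = 0 \<Longrightarrow> v = 0"
    and below: "bounded_below_on (V \<inter> orthogonal_comp {a}) f"
  shows "bounded_below_on V f"
proof (cases "V \<subseteq> orthogonal_comp {a}")
  case True
  then show ?thesis using below by (simp add: Int_absorb2)
next
  case False
  define W where "W = V \<inter> orthogonal_comp {a}"
  have lin: "linear f" using f by (rule bounded_linear.linear)
  obtain u where u: "u \<in> V" "inner a u \<noteq> 0"
    using False by (auto simp: orthogonal_comp_def orthogonal_def)
  obtain c where c: "c > 0" "\<And>v. v \<in> W \<Longrightarrow> c * norm v \<le> norm (f v)"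
    using below by (auto simp: bounded_below_on_def W_def)
  have W: "subspace W" unfolding W_def by (intro subspace_inter V subspace_orthogonal_comp)
  have "complete W" unfolding W_def complete_eq_closed
    by (intro closed_Int V closed_orthogonal_comp)
  then have "complete (f ` W)" using complete_isometric_image[OF c(1) W f] c(2) by blast
  then have closed: "closed (f ` W)" by (rule complete_imp_closed)
  have fu: "f u \<notin> f ` W"
  proof
    assume "f u \<in> f ` W"
    then obtain w where w: "w \<in> W" "f u = f w" by auto
    then have "u - w = 0" using u V(1) by (intro inj) (auto simp: W_def linear_diff[OF lin] subspace_diff)
    then show False using u w by (auto simp: W_def orthogonal_comp_def orthogonal_def)
  qed
  define \<delta> where "\<delta> = infdist (f u) (f ` W)"
  have "f ` W \<noteq> {}" using subspace_0[OF W] by auto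
  then have \<delta>: "\<delta> > 0" unfolding \<delta>_def using infdist_pos_not_in_closed[OF closed _ fu] by simp
  define D where "D = 1 / c + (norm (f u) / c + norm u) / \<delta>"
  have D: "D > 0" unfolding D_def using c(1) \<delta> by (intro add_pos_nonneg) auto
  have "norm v \<le> D * norm (f v)" if v: "v \<in> V" for v
  proof -
    define t where "t = inner a v / inner a u"
    define w where "w = v - t *\<^sub>R u"
    have w: "w \<in> W" using v u V(1)
      by (auto simp: W_def w_def t_def orthogonal_comp_def orthogonal_def inner_diff_right
          intro!: subspace_diff subspace_scale)
    have fv: "f v = f w + t *\<^sub>R f u"
      by (simp add: w_def linear_diff[OF lin] linear_scale[OF lin])
    have td: "\<bar>t\<bar> * \<delta> \<le> norm (f v)"
    proof (cases "t = 0")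
      case False
      have "- (1/t) *\<^sub>R w \<in> W" by (intro subspace_scale W w)
      then have "\<delta> \<le> dist (f u) (f (- (1/t) *\<^sub>R w))" unfolding \<delta>_def by (intro infdist_le) auto
      also have "\<dots> = norm ((1/t) *\<^sub>R f v)" using False
        by (simp add: dist_norm fv linear_scale[OF lin] linear_neg[OF lin] algebra_simps)
      also have "\<dots> = norm (f v) / \<bar>t\<bar>" by simp
      finally show ?thesis using False by (simp add: field_simps)
    qed simp
    have "norm w \<le> norm (f w) / c" using c w by (simp add: field_simps)
    also have "norm (f w) \<le> norm (f v) + \<bar>t\<bar> * norm (f u)"
      using norm_triangle_ineq4[of "f v" "t *\<^sub>R f u"] by (simp add: fv)
    finally have nw: "norm w \<le> norm (f v) / c + \<bar>t\<bar> * (norm (f u) / c)"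
      using c(1) by (simp add: divide_right_mono add_divide_distrib)
    have "norm v \<le> norm w + \<bar>t\<bar> * norm u"
      using norm_triangle_ineq[of w "t *\<^sub>R u"] by (simp add: w_def)
    also have "\<dots> \<le> norm (f v) / c + \<bar>t\<bar> * (norm (f u) / c + norm u)" using nw by (simp add: algebra_simps)
    also have "\<dots> \<le> norm (f v) / c + (norm (f v) / \<delta>) * (norm (f u) / c + norm u)"
      using td \<delta> c(1) by (intro add_left_mono mult_right_mono) (auto simp: field_simps)
    also have "\<dots> = D * norm (f v)" by (simp add: D_def algebra_simps add_divide_distrib)
    finally show ?thesis .
  qed
  then show ?thesis unfolding bounded_below_on_def using D
    by (intro exI[of _ "1 / D"]) (auto simp: field_simps)
qed

text \<open>Finite codimension costs at most a kernel: the constraints are removed one at a time, and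
  injectivity on all of \<open>V\<close> passes to every intermediate subspace.\<close>

lemma bounded_below_on_drop_finite:
  fixes f :: "'a::{real_inner,banach} \<Rightarrow> 'b::real_normed_vector"
  assumes "finite F" and f: "bounded_linear f" and "subspace V" "closed V"
    and "\<And>v. v \<in> V \<Longrightarrow> f v = 0 \<Longrightarrow> v = 0"
    and "bounded_below_on (V \<inter> orthogonal_comp F) f"
  shows "bounded_below_on V f"
  using assms(1,3-)
proof (induction F arbitrary: V)
  case empty
  then show ?case by (simp add: orthogonal_comp_def)
next
  case (insert a F)
  have "V \<inter> orthogonal_comp {a} \<inter> orthogonal_comp F = V \<inter> orthogonal_comp (insert a F)"
    by (auto simp: orthogonal_comp_def)
  then have "bounded_below_on (V \<inter> orthogonal_comp {a}) f"
    using insert.prems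
    by - (rule insert.IH; simp add: subspace_inter subspace_orthogonal_comp closed_Int closed_orthogonal_comp)
  with insert.prems(1-3) show ?case by (rule bounded_below_on_drop_constraint[OF f])
qed

section \<open>Isolated points of the spectrum\<close>

text \<open>The bound on the range extends to its closure \<open>V\<close>, where \<open>K\<^sup>2\<close> is therefore coercive. Solving
  \<open>K\<^sup>2 x = K v\<close> in \<open>V\<close> puts \<open>v - K x\<close> into the kernel. If \<open>v\<close> is orthogonal to the kernel, then
  \<open>v - K x\<close> is orthogonal to itself, so \<open>v\<close> already lies in the range.\<close>

lemma bounded_below_orthogonal_kernel:
  fixes K :: "'a::{real_inner,banach} \<Rightarrow> 'a"
  assumes K: "symmetric_map K" and \<rho>: "\<rho> > 0" and range: "\<And>v. \<rho> * norm (K v) \<le> norm (K (K v))"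
    and v: "v \<in> orthogonal_comp {u. K u = 0}"
  shows "\<rho> * norm v \<le> norm (K v)"
proof -
  have bl: "bounded_linear K" and inn: "\<And>u v. inner (K u) v = inner u (K v)"
    using K by (auto simp: symmetric_map_def)
  have lin: "linear K" using bl by (rule bounded_linear.linear)
  have cont: "continuous_on UNIV K" using bl by (simp add: linear_continuous_on)
  define V where "V = closure (range K)"
  have limit: "x \<in> V" if "\<And>n. f n \<in> range K" "f \<longlonglongrightarrow> x" for f :: "nat \<Rightarrow> 'a" and x
    using that by (auto simp: V_def closure_sequential)
  have sub: "subspace V"
  proof (rule subspaceI)
    show "0 \<in> V" unfolding V_def using closure_subset linear_0[OF lin] by (metis rangeI subsetD)
  next
    fix x y assume "x \<in> V" "y \<in> V"
    then obtain f g where f: "\<And>n. f n \<in> range K" "f \<longlonglongrightarrow> x" and g: "\<And>n. g n \<in> range K" "g \<longlonglongrightarrow> y"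
      by (auto simp: V_def closure_sequential)
    have "f n + g n \<in> range K" for n
      using f(1)[of n] g(1)[of n] by (auto simp: linear_add[OF lin, symmetric])
    then show "x + y \<in> V" using tendsto_add[OF f(2) g(2)] by (rule limit)
  next
    fix x and c :: real assume "x \<in> V"
    then obtain f where f: "\<And>n. f n \<in> range K" "f \<longlonglongrightarrow> x"
      by (auto simp: V_def closure_sequential)
    have "c *\<^sub>R f n \<in> range K" for n
      using f(1)[of n] by (auto simp: linear_scale[OF lin, symmetric])
    then show "c *\<^sub>R x \<in> V" using tendsto_scaleR[OF tendsto_const f(2)] by (rule limit)
  qed
  have KV: "K x \<in> V" for x
    using closure_subset[of "range K"] by (auto simp: V_def)
  have Vbelow: "\<rho> * norm w \<le> norm (K w)" if "w \<in> V" for w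
  proof -
    have "closed {w. \<rho> * norm w \<le> norm (K w)}"
      by (intro closed_Collect_le continuous_intros cont)
    moreover have "range K \<subseteq> {w. \<rho> * norm w \<le> norm (K w)}" using range by auto
    ultimately have "V \<subseteq> {w. \<rho> * norm w \<le> norm (K w)}" unfolding V_def by (rule closure_minimal[rotated])
    then show ?thesis using that by auto
  qed
  have "\<exists>x\<in>V. K (K x) = K v"
  proof (rule coercive_surjective[of V "\<lambda>x. K (K x)" "\<rho>\<^sup>2"])
    show "complete V" by (simp add: V_def complete_eq_closed)
    show "bounded_linear (\<lambda>x. K (K x))" by (intro bounded_linear_compose[OF bl] bl)
    fix w assume "w \<in> V"
    then have "(\<rho> * norm w)\<^sup>2 \<le> (norm (K w))\<^sup>2" using Vbelow \<rho> by (intro power_mono) auto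
    then show "\<rho>\<^sup>2 * (norm w)\<^sup>2 \<le> inner (K (K w)) w"
      by (simp add: power_mult_distrib inn power2_norm_eq_inner)
  qed (use sub KV \<rho> in auto)
  then obtain x where x: "K (K x) = K v" by blast
  have ker: "K (v - K x) = 0" using x by (simp add: linear_diff[OF lin])
  then have "inner (v - K x) v = 0" using v by (auto simp: orthogonal_comp_def orthogonal_def)
  moreover have "inner (v - K x) (K x) = 0" using ker by (simp add: inn[symmetric])
  ultimately have "inner (v - K x) (v - K x) = 0" by (simp only: inner_diff_right)
  then have "v = K x" by simp
  then show ?thesis using range by simp
qed

text \<open>If \<open>0\<close> is the only possible spectral point of \<open>K\<close> in \<open>(-e, e)\<close>, then \<open>K\<^sup>2\<close> has none in
  \<open>(0, e\<^sup>2)\<close>. So the midpoint \<open>t = e\<^sup>2 / 2\<close> keeps distance \<open>t\<close> from the spectrum of \<open>K\<^sup>2\<close>, and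
  squaring the resulting bound \<open>t * norm v \<le> norm (K\<^sup>2 v - t v)\<close> gives the claim.\<close>

lemma bounded_below_range_of_punctured:
  fixes K :: "'a::real_inner \<Rightarrow> 'a"
  assumes K: "symmetric_map K" and e: "e > 0"
    and below: "\<And>s. 0 < \<bar>s\<bar> \<Longrightarrow> \<bar>s\<bar> < e \<Longrightarrow> bounded_below_on UNIV (\<lambda>v. K v - s *\<^sub>R v)"
  shows "e * norm (K v) \<le> norm (K (K v))"
proof -
  have inn: "\<And>u v. inner (K u) v = inner u (K v)" and lin: "linear K"
    using K by (auto simp: symmetric_map_def bounded_linear.linear)
  define t where "t = e\<^sup>2 / 2"
  have t: "t > 0" using e by (simp add: t_def)
  have main: "t * norm v \<le> norm (K (K v) - t *\<^sub>R v)" for v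
  proof (rule ccontr)
    \<comment> \<open>The estimate applies to bounds \<open>d\<close> strictly below \<open>t\<close>, which keeps \<open>\<mu>\<close> strictly inside \<open>(0, e\<^sup>2)\<close>.\<close>
    assume "\<not> ?thesis"
    then have less: "norm (K (K v) - t *\<^sub>R v) < t * norm v" by simp
    then have v0: "norm v > 0" by (cases "v = 0") auto
    then have "norm (K (K v) - t *\<^sub>R v) / norm v < t" using less by (simp add: field_simps)
    then obtain d where d: "norm (K (K v) - t *\<^sub>R v) / norm v < d" "d < t" using dense by blast
    have d0: "d \<ge> 0" using d(1) by (meson divide_nonneg_nonneg norm_ge_zero order.trans less_imp_le)
    have "norm (K (K v) - t *\<^sub>R v) < d * norm v" using d(1) v0 by (simp add: field_simps)
    then obtain \<mu> where \<mu>: "\<bar>\<mu> - t\<bar> \<le> d" and nb: "\<not> bounded_below_on UNIV (\<lambda>v. K (K v) - \<mu> *\<^sub>R v)"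
      using approximate_eigenvalue_near[OF test_family_UNIV symmetric_map_comp_self[OF K] d0, of t] by auto
    define s where "s = sqrt \<mu>"
    have m: "0 < \<mu>" "\<mu> < e\<^sup>2" using \<mu> d(2) by (auto simp: t_def abs_le_iff)
    then have s: "0 < s" "s < e" "\<mu> = s * s"
      using e by (auto simp: s_def real_less_lsqrt)
    have "bounded_below_on UNIV (\<lambda>v. (\<lambda>u. K u - s *\<^sub>R u) (K v - (- s) *\<^sub>R v))"
      using bounded_below_on_comp[OF test_family_UNIV, of "\<lambda>v. K v - (- s) *\<^sub>R v" "\<lambda>u. K u - s *\<^sub>R u"]
        below[of s] below[of "-s"] s symmetric_map_add_scaleR[OF K, of s] by simp
    moreover have "(\<lambda>v. (\<lambda>u. K u - s *\<^sub>R u) (K v - (- s) *\<^sub>R v)) = (\<lambda>v. K (K v) - \<mu> *\<^sub>R v)"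
      by (simp add: fun_eq_iff s(3) linear_add[OF lin] linear_scale[OF lin] algebra_simps)
    ultimately show False using nb by simp
  qed
  have "(t * norm v)\<^sup>2 \<le> (norm (K (K v) - t *\<^sub>R v))\<^sup>2" using main t by (intro power_mono) auto
  also have "\<dots> = (norm (K (K v)))\<^sup>2 - 2 * t * (norm (K v))\<^sup>2 + (t * norm v)\<^sup>2"
    using inner_commute[of v "K (K v)"] inn[of "K v" v]
    by (simp only: power2_norm_eq_inner power_mult_distrib inner_diff_left inner_diff_right
          inner_scaleR_left inner_scaleR_right) (simp add: power2_eq_square right_diff_distrib)
  finally have "(e * norm (K v))\<^sup>2 \<le> (norm (K (K v)))\<^sup>2" by (simp add: t_def power_mult_distrib)
  then show ?thesis by (rule power2_le_imp_le) simp
qed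

section \<open>The complex structure\<close>

interpretation complex_scaling: vector_space "scaleC :: complex \<Rightarrow> 'a \<Rightarrow> 'a::complex_inner"
  by (rule vector_space_scaleC)

lemma cinner_scaleC_right: "cinner u (z *\<^sub>C v) = cnj z * cinner u v"
  by (subst (1 2) cinner_commute) (simp add: cinner_scaleC_left)

lemma inner_scaleC: "inner (z *\<^sub>C u) v = inner u (cnj z *\<^sub>C v)"
  by (simp add: inner_cinner cinner_scaleC_left cinner_scaleC_right)

lemma norm_scaleC: "norm (z *\<^sub>C v) = cmod z * norm v"
proof -
  have "inner (z *\<^sub>C v) (z *\<^sub>C v) = (cmod z)\<^sup>2 * inner v v"
    by (simp add: inner_scaleC scaleC_scaleC mult.commute[of "cnj z"] complex_norm_square[symmetric]
        scaleR_scaleC[symmetric] del: of_real_power)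
  then have "(norm (z *\<^sub>C v))\<^sup>2 = (cmod z * norm v)\<^sup>2"
    by (simp add: power2_norm_eq_inner power_mult_distrib)
  then show ?thesis by (rule power2_eq_imp_eq) auto
qed

lemma bounded_linear_scaleC: "bounded_linear (\<lambda>v. z *\<^sub>C v)"
  by (rule bounded_linear_intro[where K = "cmod z"])
    (simp_all add: scaleC_add_right scaleR_scaleC scaleC_scaleC norm_scaleC mult.commute)

lemma bounded_linear_shift: "bounded_linear (\<lambda>v. blinfun_apply T v - z *\<^sub>C v)"
  by (intro bounded_linear_sub blinfun.bounded_linear_right bounded_linear_scaleC)

lemma self_adjoint_inner: "self_adjoint T \<Longrightarrow> inner (T u) v = inner u (T v)"
  by (simp add: self_adjoint_def inner_cinner)

lemma self_adjoint_symmetric_shift: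
  assumes "self_adjoint T"
  shows "symmetric_map (\<lambda>v. T v - r *\<^sub>R v)"
  using symmetric_map_add_scaleR[of "blinfun_apply T" "- r"] self_adjoint_inner[OF assms]
  by (simp add: symmetric_map_def blinfun.bounded_linear_right)

section \<open>The spectrum of a self-adjoint operator\<close>

text \<open>Both \<open>T v\<close> and \<open>v\<close> are orthogonal, in the real sense, to \<open>\<i> v\<close>. Testing \<open>T v - z v\<close> against
  \<open>\<i> v\<close> therefore isolates the imaginary part of \<open>z\<close>.\<close>

lemma self_adjoint_nonreal_bounded_below:
  assumes T: "complex_linear T" "self_adjoint T"
  shows "\<bar>Im z\<bar> * norm v \<le> norm (T v - z *\<^sub>C v)"
proof -
  have rot: "inner w (\<i> *\<^sub>C v) = - inner (\<i> *\<^sub>C w) v" for w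
    by (simp add: inner_scaleC)
  have "inner (T v) (\<i> *\<^sub>C v) = - inner (T v) (\<i> *\<^sub>C v)"
    unfolding rot[of "T v"] using T self_adjoint_inner[OF T(2)]
    by (metis complex_linear_def inner_commute rot)
  then have "inner (T v) (\<i> *\<^sub>C v) = 0" by simp
  moreover have "inner v (\<i> *\<^sub>C v) = 0" using rot[of v] by (simp add: inner_commute)
  moreover have "z *\<^sub>C v = Re z *\<^sub>R v + Im z *\<^sub>R (\<i> *\<^sub>C v)"
    by (subst complex_eq[of z]) (simp add: scaleC_add_left scaleR_scaleC scaleC_scaleC mult.commute)
  moreover have "inner (\<i> *\<^sub>C v) (\<i> *\<^sub>C v) = (norm v)\<^sup>2"
    by (simp add: power2_norm_eq_inner[symmetric] norm_scaleC)
  ultimately have "inner (T v - z *\<^sub>C v) (\<i> *\<^sub>C v) = - Im z * (norm v)\<^sup>2"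
    by (simp add: inner_diff_left inner_add_left)
  then have "\<bar>Im z\<bar> * (norm v)\<^sup>2 = \<bar>inner (T v - z *\<^sub>C v) (\<i> *\<^sub>C v)\<bar>" by (simp add: abs_mult)
  also have "\<dots> \<le> norm (T v - z *\<^sub>C v) * norm v"
    using Cauchy_Schwarz_ineq2[of "T v - z *\<^sub>C v" "\<i> *\<^sub>C v"] by (simp add: norm_scaleC)
  finally show ?thesis
    by (cases "v = 0") (simp_all add: power2_eq_square mult.assoc[symmetric])
qed

text \<open>If the normal operator \<open>R = T - z\<close> is bounded below by \<open>c\<close>, then so is its adjoint, and
  \<open>R R\<^sup>*\<close> is coercive with constant \<open>c\<^sup>2\<close>. It is thus surjective, which makes \<open>R\<close> surjective; the
  lower bound gives injectivity and the bound of the inverse.\<close>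

lemma op_spectrum_iff_not_bounded_below:
  fixes T :: "'a::chilbert_space \<Rightarrow>\<^sub>L 'a"
  assumes T: "complex_linear T" "self_adjoint T"
  shows "z \<in> op_spectrum T \<longleftrightarrow> \<not> bounded_below_on UNIV (\<lambda>v. T v - z *\<^sub>C v)"
proof
  assume z: "z \<in> op_spectrum T"
  show "\<not> bounded_below_on UNIV (\<lambda>v. T v - z *\<^sub>C v)"
  proof
    define R where "R w v = T v - w *\<^sub>C v" for w v
    assume "bounded_below_on UNIV (\<lambda>v. T v - z *\<^sub>C v)"
    then obtain c where c: "c > 0" "\<And>v. c * norm v \<le> norm (R z v)"
      unfolding bounded_below_on_def R_def by auto
    have R: "bounded_linear (R w)" for w unfolding R_def by (rule bounded_linear_shift)
    have adj: "inner (R w u) v = inner u (R (cnj w) v)" for w u v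
      by (simp add: R_def inner_diff_left inner_diff_right self_adjoint_inner[OF T(2)] inner_scaleC)
    have comm: "R z (R (cnj z) v) = R (cnj z) (R z v)" for v
      using T(1) by (simp add: R_def complex_linear_def blinfun.diff_right
          complex_scaling.scale_right_diff_distrib scaleC_scaleC mult.commute)
    have normal: "norm (R (cnj z) v) = norm (R z v)" for v
      using adj[of z v "R z v"] adj[of "cnj z" v "R (cnj z) v"] comm[of v]
      by (simp add: norm_eq_sqrt_inner)
    have surj: "\<exists>x. R z x = y" for y
    proof -
      have "\<exists>x\<in>UNIV. R z (R (cnj z) x) = y"
      proof (rule coercive_surjective[of UNIV "\<lambda>x. R z (R (cnj z) x)" "c\<^sup>2"])
        show "bounded_linear (\<lambda>x. R z (R (cnj z) x))" by (intro bounded_linear_compose[OF R] R)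
        show "c\<^sup>2 * (norm v)\<^sup>2 \<le> inner (R z (R (cnj z) v)) v" for v
          using power_mono[OF c(2)[of v], of 2] c(1)
          by (simp add: adj power_mult_distrib power2_norm_eq_inner[symmetric] normal)
      qed (use c(1) in \<open>auto simp: complete_UNIV\<close>)
      then show ?thesis by blast
    qed
    define G where "G = inv (R z)"
    have inj: "u = v" if "R z u = R z v" for u v
      using c(1) c(2)[of "u - v"] that bounded_linear.linear[OF R[of z]]
      by (simp add: linear_diff mult_le_0_iff)
    have RG: "R z (G v) = v" for v unfolding G_def using surj by (metis f_inv_into_f rangeI)
    have RC: "R z (w *\<^sub>C v) = w *\<^sub>C R z v" for w v
      using T(1) by (simp add: R_def complex_linear_def complex_scaling.scale_right_diff_distrib
          scaleC_scaleC mult.commute)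
    have GC: "G (w *\<^sub>C v) = w *\<^sub>C G v" for w v
      by (rule inj) (simp add: RG RC)
    have G: "bounded_linear G"
    proof (rule bounded_linear_intro[where K = "1 / c"])
      show "G (x + y) = G x + G y" for x y
        by (rule inj) (simp add: RG linear_add[OF bounded_linear.linear[OF R]])
      show "G (r *\<^sub>R x) = r *\<^sub>R G x" for r x by (simp add: scaleR_scaleC GC)
      show "norm (G x) \<le> norm x * (1 / c)" for x
        using c(2)[of "G x"] c(1) by (simp add: RG field_simps)
    qed
    have "complex_linear (Blinfun G)"
      using GC by (simp add: complex_linear_def bounded_linear_Blinfun_apply[OF G])
    moreover have "Blinfun G (T v - z *\<^sub>C v) = v" for v
      using inj RG by (simp add: bounded_linear_Blinfun_apply[OF G] R_def[symmetric])
    moreover have "T (Blinfun G v) - z *\<^sub>C Blinfun G v = v" for v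
      using RG by (simp add: bounded_linear_Blinfun_apply[OF G] R_def)
    ultimately show False using z unfolding op_spectrum_def by blast
  qed
next
  assume not_below: "\<not> bounded_below_on UNIV (\<lambda>v. T v - z *\<^sub>C v)"
  show "z \<in> op_spectrum T"
  proof (rule ccontr)
    assume "z \<notin> op_spectrum T"
    then obtain S :: "'a \<Rightarrow>\<^sub>L 'a" where S: "\<And>v. S (T v - z *\<^sub>C v) = v"
      unfolding op_spectrum_def by blast
    have "1 / (norm S + 1) * norm v \<le> norm (T v - z *\<^sub>C v)" for v
    proof -
      have "norm v \<le> norm S * norm (T v - z *\<^sub>C v)"
        using norm_blinfun[of S "T v - z *\<^sub>C v"] by (simp add: S)
      also have "\<dots> \<le> (norm S + 1) * norm (T v - z *\<^sub>C v)" by (simp add: distrib_right)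
      finally have "norm v \<le> (norm S + 1) * norm (T v - z *\<^sub>C v)" .
      moreover have "norm S + 1 > 0" by (simp add: add_nonneg_pos)
      ultimately show ?thesis by (simp add: pos_divide_le_eq mult.commute)
    qed
    then have "bounded_below_on UNIV (\<lambda>v. T v - z *\<^sub>C v)"
      unfolding bounded_below_on_def by (intro exI[of _ "1 / (norm S + 1)"]) (simp add: add_nonneg_pos)
    then show False using not_below by simp
  qed
qed

section \<open>The essential spectrum and finite codimension\<close>

text \<open>Each constraint costs at most one complex dimension: a vector of \<open>N\<close> that \<open>f\<close> does not annihilate
  spans \<open>N\<close> together with the part of \<open>N\<close> that \<open>f\<close> annihilates.\<close>

lemma subspace_finite_span:
  fixes N :: "'a::complex_inner set"
  assumes "finite F" and "module.subspace scaleC N"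
    and "\<And>v. v \<in> N \<Longrightarrow> (\<And>f. f \<in> F \<Longrightarrow> cinner v f = 0) \<Longrightarrow> v = 0"
  shows "\<exists>B. finite B \<and> N = module.span scaleC B"
  using assms
proof (induction F arbitrary: N)
  case empty
  then have "N = {0}" using complex_scaling.subspace_0 by auto
  then show ?case by (intro exI[of _ "{}"]) simp
next
  case (insert f F)
  note sub = insert.prems(1)
  define N' where "N' = {v \<in> N. cinner v f = 0}"
  have c0: "cinner 0 f = 0" using cinner_add_left[of 0 0 f] by simp
  have "module.subspace scaleC N'"
    unfolding N'_def using sub
    by (auto simp: complex_scaling.subspace_def cinner_add_left cinner_scaleC_left c0)
  then obtain B where B: "finite B" "N' = module.span scaleC B"
    using insert.IH[of N'] insert.prems(2) by (auto simp: N'_def)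
  show ?case
  proof (cases "N' = N")
    case True
    then show ?thesis using B by blast
  next
    case False
    then obtain u where u: "u \<in> N" "cinner u f \<noteq> 0" by (auto simp: N'_def)
    have "N = module.span scaleC (insert u B)"
    proof
      show "module.span scaleC (insert u B) \<subseteq> N"
        using u B(2) complex_scaling.span_superset[of B] sub
        by (intro complex_scaling.span_minimal) (auto simp: N'_def)
      show "N \<subseteq> module.span scaleC (insert u B)"
      proof
        fix v assume v: "v \<in> N"
        define k where "k = cinner v f / cinner u f"
        have "cinner v f = cinner (v - k *\<^sub>C u) f + cinner (k *\<^sub>C u) f"
          by (simp add: cinner_add_left[symmetric])
        then have "cinner (v - k *\<^sub>C u) f = 0" using u by (simp add: cinner_scaleC_left k_def)
        then have "v - k *\<^sub>C u \<in> N'" using u v sub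
          by (auto simp: N'_def complex_scaling.subspace_diff complex_scaling.subspace_scale)
        then show "v \<in> module.span scaleC (insert u B)"
          unfolding B(2) complex_scaling.span_insert by blast
      qed
    qed
    then show ?thesis using B(1) by blast
  qed
qed

lemma subspace_eigenspace:
  assumes "complex_linear T"
  shows "module.subspace scaleC (eigenspace T z)"
  using assms
  by (auto simp: complex_scaling.subspace_def eigenspace_def blinfun.add_right complex_linear_def
      scaleC_add_right scaleC_scaleC mult.commute)

text \<open>Half of a Weyl criterion. For every complex \<open>w\<close> close to \<open>r\<close> the operator \<open>T - w\<close> is still bounded
  below up to the constraints \<open>F\<close>, so \<open>w\<close> is a spectral point only if it is an eigenvalue. Hence a
  spectral point \<open>r\<close> is an eigenvalue, and its eigenspace \<open>N\<close> meets the complement of \<open>F\<close> trivially,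
  so it has finite dimension. It is also isolated: an eigenvector for a nearby real \<open>s \<noteq> r\<close> would
  be orthogonal to \<open>N\<close>, where \<open>T - r\<close>, being injective, is bounded below, yet \<open>T - r\<close> only
  multiplies it by \<open>s - r\<close>.\<close>

lemma not_essential_if_bounded_below:
  fixes T :: "'a::chilbert_space \<Rightarrow>\<^sub>L 'a"
  assumes T: "complex_linear T" "self_adjoint T" and F: "finite F"
    and below: "bounded_below_on (orthogonal_comp F) (\<lambda>v. T v - r *\<^sub>R v)"
  shows "complex_of_real r \<notin> essential_spectrum T"
proof (cases "complex_of_real r \<in> op_spectrum T")
  case False
  then show ?thesis by (simp add: essential_spectrum_def)
next
  case True
  let ?z = "complex_of_real r"
  define N where "N = eigenspace T ?z"
  have N: "v \<in> N \<longleftrightarrow> T v = r *\<^sub>R v" for v by (simp add: N_def eigenspace_def scaleR_scaleC)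
  obtain c where c: "c > 0" "\<And>v. v \<in> orthogonal_comp F \<Longrightarrow> c * norm v \<le> norm (T v - r *\<^sub>R v)"
    using below by (auto simp: bounded_below_on_def)
  have invertible: "w \<notin> op_spectrum T"
    if w: "cmod (w - ?z) < c" and inj: "\<And>v. T v = w *\<^sub>C v \<Longrightarrow> v = 0" for w
  proof -
    have "(c - cmod (w - ?z)) * norm v \<le> norm (T v - w *\<^sub>C v)" if "v \<in> orthogonal_comp F" for v
    proof -
      have "T v - r *\<^sub>R v = (T v - w *\<^sub>C v) + (w - ?z) *\<^sub>C v"
        by (simp add: complex_scaling.scale_left_diff_distrib scaleR_scaleC)
      then have "norm (T v - r *\<^sub>R v) \<le> norm (T v - w *\<^sub>C v) + norm ((w - ?z) *\<^sub>C v)"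
        by (simp only: norm_triangle_ineq)
      then have "norm (T v - r *\<^sub>R v) \<le> norm (T v - w *\<^sub>C v) + cmod (w - ?z) * norm v"
        by (simp only: norm_scaleC)
      then show ?thesis using c(2)[OF that] by (simp add: left_diff_distrib)
    qed
    then have "bounded_below_on (UNIV \<inter> orthogonal_comp F) (\<lambda>v. T v - w *\<^sub>C v)"
      using w unfolding bounded_below_on_def by (intro exI[of _ "c - cmod (w - ?z)"]) auto
    then have "bounded_below_on UNIV (\<lambda>v. T v - w *\<^sub>C v)"
      using inj by - (rule bounded_below_on_drop_finite[OF F bounded_linear_shift subspace_UNIV closed_UNIV]; simp)
    then show ?thesis using op_spectrum_iff_not_bounded_below[OF T] by blast
  qed
  have eigen: "\<exists>v\<in>N. v \<noteq> 0"
    using invertible[of ?z] c(1) True N by (auto simp: scaleR_scaleC)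
  have fin: "\<exists>B. finite B \<and> N = module.span scaleC B"
  proof (rule subspace_finite_span[OF F])
    show "module.subspace scaleC N" unfolding N_def by (rule subspace_eigenspace[OF T(1)])
    fix v assume v: "v \<in> N" and "\<And>f. f \<in> F \<Longrightarrow> cinner v f = 0"
    then have "inner v f = 0" if "f \<in> F" for f using that by (simp add: inner_cinner)
    then have "v \<in> orthogonal_comp F"
      by (simp add: orthogonal_comp_def orthogonal_def inner_commute)
    then have "c * norm v \<le> 0" using c(2)[of v] v by (simp add: N)
    then show "v = 0" using c(1) by (simp add: mult_le_0_iff)
  qed
  have "bounded_below_on (orthogonal_comp N) (\<lambda>v. T v - ?z *\<^sub>C v)"
  proof (rule bounded_below_on_drop_finite[OF F bounded_linear_shift subspace_orthogonal_comp closed_orthogonal_comp])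
    show "bounded_below_on (orthogonal_comp N \<inter> orthogonal_comp F) (\<lambda>v. T v - ?z *\<^sub>C v)"
      using c by (auto simp: bounded_below_on_def scaleR_scaleC)
    fix v assume "v \<in> orthogonal_comp N" "T v - ?z *\<^sub>C v = 0"
    then have "inner v v = 0" by (auto simp: orthogonal_comp_def orthogonal_def N scaleR_scaleC)
    then show "v = 0" by simp
  qed
  then obtain c' where c': "c' > 0" "\<And>v. v \<in> orthogonal_comp N \<Longrightarrow> c' * norm v \<le> norm (T v - r *\<^sub>R v)"
    by (auto simp: bounded_below_on_def scaleR_scaleC)
  have "w = ?z" if w: "w \<in> op_spectrum T" "dist ?z w < min c c'" for w
  proof (rule ccontr)
    assume ne: "w \<noteq> ?z"
    have "v = 0" if v: "T v = w *\<^sub>C v" for v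
    proof (cases "Im w = 0")
      case False
      then show ?thesis using self_adjoint_nonreal_bounded_below[OF T, of w v] v by (simp add: mult_le_0_iff)
    next
      case True
      define s where "s = Re w"
      have ws: "w = complex_of_real s" using True by (simp add: s_def complex_eq_iff)
      then have Tv: "T v = s *\<^sub>R v" and sr: "s \<noteq> r" "\<bar>s - r\<bar> < c'"
        using v ne w(2) by (auto simp: scaleR_scaleC dist_norm simp flip: of_real_diff)
      have "inner u v = 0" if "u \<in> N" for u
      proof -
        have "s * inner u v = inner u (T v)" by (simp add: Tv)
        also have "\<dots> = inner (T u) v" by (simp add: self_adjoint_inner[OF T(2)])
        also have "\<dots> = r * inner u v" using that by (simp add: N)
        finally show ?thesis using sr by simp
      qed
      then have "c' * norm v \<le> norm (T v - r *\<^sub>R v)"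
        by (intro c') (auto simp: orthogonal_comp_def orthogonal_def)
      also have "T v - r *\<^sub>R v = (s - r) *\<^sub>R v" by (simp add: Tv scaleR_left_diff_distrib)
      finally have "(c' - \<bar>s - r\<bar>) * norm v \<le> 0" by (simp add: left_diff_distrib)
      then show ?thesis using sr by (simp add: mult_le_0_iff)
    qed
    then show False using invertible[of w] w by (auto simp: dist_norm norm_minus_commute)
  qed
  then have "?z isolated_in op_spectrum T"
    unfolding isolated_in_dist_Ex_iff using True c(1) c'(1) by (intro conjI exI[of _ "min c c'"]) auto
  then show ?thesis using eigen fin by (simp add: essential_spectrum_def discrete_spectrum_def N_def)
qed

text \<open>The other half. At a discrete point \<open>T - r\<close> is bounded below on the orthogonal complement of
  the eigenspace, by the two lemmas on isolated points of the spectrum above. A finite spanning set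
  \<open>B\<close> of the eigenspace yields the constraints; orthogonality in the complex sense to \<open>b\<close> is real
  orthogonality to \<open>b\<close> and to \<open>\<i> b\<close>.\<close>

lemma bounded_below_if_not_essential:
  fixes T :: "'a::chilbert_space \<Rightarrow>\<^sub>L 'a"
  assumes T: "complex_linear T" "self_adjoint T"
    and r: "complex_of_real r \<notin> essential_spectrum T"
  shows "\<exists>F. finite F \<and> bounded_below_on (orthogonal_comp F) (\<lambda>v. T v - r *\<^sub>R v)"
proof (cases "complex_of_real r \<in> op_spectrum T")
  case False
  then show ?thesis using op_spectrum_iff_not_bounded_below[OF T]
    by (intro exI[of _ "{}"]) (auto simp: orthogonal_comp_def scaleR_scaleC)
next
  case True
  let ?z = "complex_of_real r"
  define K where "K v = T v - r *\<^sub>R v" for v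
  have K: "symmetric_map K" unfolding K_def[abs_def] by (rule self_adjoint_symmetric_shift[OF T(2)])
  have disc: "?z \<in> discrete_spectrum T" using True r by (simp add: essential_spectrum_def)
  then obtain e where e: "e > 0" "\<And>w. w \<in> op_spectrum T \<Longrightarrow> dist ?z w < e \<Longrightarrow> w = ?z"
    by (auto simp: discrete_spectrum_def isolated_in_dist_Ex_iff)
  obtain B where B: "finite B" "eigenspace T ?z = module.span scaleC B"
    using disc by (auto simp: discrete_spectrum_def)
  have "bounded_below_on UNIV (\<lambda>v. K v - s *\<^sub>R v)" if "0 < \<bar>s\<bar>" "\<bar>s\<bar> < e" for s
  proof -
    have "dist ?z (complex_of_real (r + s)) < e" using that by (simp add: dist_norm)
    then have "complex_of_real (r + s) \<notin> op_spectrum T" using e(2) that by fastforce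
    then show ?thesis using op_spectrum_iff_not_bounded_below[OF T]
      by (simp add: K_def scaleR_scaleC[symmetric] scaleR_left_distrib diff_diff_eq del: of_real_add)
  qed
  then have "e * norm (K v) \<le> norm (K (K v))" for v
    by (rule bounded_below_range_of_punctured[OF K e(1)])
  then have below: "e * norm v \<le> norm (K v)" if "v \<in> orthogonal_comp {u. K u = 0}" for v
    using bounded_below_orthogonal_kernel[OF K e(1)] that by blast
  define F where "F = B \<union> (\<lambda>b. \<i> *\<^sub>C b) ` B"
  have "v \<in> orthogonal_comp {u. K u = 0}" if v: "v \<in> orthogonal_comp F" for v
  proof -
    have "cinner b v = 0" if "b \<in> B" for b
    proof -
      have "inner b v = 0" "inner (\<i> *\<^sub>C b) v = 0"
        using v that by (auto simp: F_def orthogonal_comp_def orthogonal_def)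
      then show ?thesis by (simp add: inner_cinner cinner_scaleC_left complex_eq_iff)
    qed
    moreover have "cinner 0 v = 0" using cinner_add_left[of 0 0 v] by simp
    then have "module.subspace scaleC {u. cinner u v = 0}"
      by (auto simp: complex_scaling.subspace_def cinner_add_left cinner_scaleC_left)
    ultimately have "module.span scaleC B \<subseteq> {u. cinner u v = 0}"
      by (intro complex_scaling.span_minimal) auto
    moreover have "u \<in> module.span scaleC B" if "K u = 0" for u
      using that unfolding B(2)[symmetric] by (simp add: K_def eigenspace_def scaleR_scaleC)
    ultimately have "cinner u v = 0" if "K u = 0" for u using that by blast
    then show ?thesis by (simp add: orthogonal_comp_def orthogonal_def inner_cinner)
  qed
  then have "bounded_below_on (orthogonal_comp F) (\<lambda>v. T v - r *\<^sub>R v)"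
    using below e(1) by (auto simp: bounded_below_on_def K_def)
  moreover have "finite F" using B(1) by (simp add: F_def)
  ultimately show ?thesis by blast
qed

section \<open>Stability of essential gaps\<close>

text \<open>Failure of the lower bound for \<open>S - r\<close> on every complement of a finite set forces a
  vector \<open>v\<close> in each of them with \<open>norm (T v - r v) < d * norm v\<close>. The distance
  estimate then finds an essential spectral point of \<open>T\<close> nearby.\<close>

lemma essential_spectrum_near:
  fixes S T :: "'a::chilbert_space \<Rightarrow>\<^sub>L 'a"
  assumes S: "complex_linear S" "self_adjoint S" and T: "complex_linear T" "self_adjoint T"
    and d: "norm (S - T) < d" and r: "complex_of_real r \<in> essential_spectrum S"
  shows "\<exists>q. \<bar>q - r\<bar> \<le> d \<and> complex_of_real q \<in> essential_spectrum T"
proof -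
  have T': "symmetric_map (blinfun_apply T)"
    using self_adjoint_symmetric_shift[OF T(2), of 0] by simp
  have "\<exists>v\<in>M. norm (T v - r *\<^sub>R v) < d * norm v" if M: "M \<in> {orthogonal_comp F | F. finite F}" for M
  proof (rule ccontr)
    assume neg: "\<not> ?thesis"
    have "(d - norm (S - T)) * norm v \<le> norm (S v - r *\<^sub>R v)" if "v \<in> M" for v
    proof -
      have "d * norm v \<le> norm (T v - r *\<^sub>R v)" using neg that by (auto simp: not_less)
      also have "T v - r *\<^sub>R v = (S v - r *\<^sub>R v) - (S - T) v" by (simp add: blinfun.diff_left)
      also have "norm \<dots> \<le> norm (S v - r *\<^sub>R v) + norm (S - T) * norm v"
        using norm_triangle_ineq4[of "S v - r *\<^sub>R v" "(S - T) v"] norm_blinfun[of "S - T" v] by simp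
      finally show ?thesis by (simp add: left_diff_distrib)
    qed
    then have "bounded_below_on M (\<lambda>v. S v - r *\<^sub>R v)"
      using d by (auto simp: bounded_below_on_def intro!: exI[of _ "d - norm (S - T)"])
    then show False using not_essential_if_bounded_below[OF S] M r by blast
  qed
  moreover have "d \<ge> 0" using d norm_ge_zero[of "S - T"] by linarith
  ultimately obtain q where "\<bar>q - r\<bar> \<le> d"
    "\<forall>M\<in>{orthogonal_comp F | F. finite F}. \<not> bounded_below_on M (\<lambda>v. T v - q *\<^sub>R v)"
    using approximate_eigenvalue_near[OF test_family_orthogonal_comp T', of d r] by blast
  then show ?thesis using bounded_below_if_not_essential[OF T] by blast
qed

lemma op_spectrum_bounded:
  fixes T :: "'a::chilbert_space \<Rightarrow>\<^sub>L 'a"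
  assumes T: "complex_linear T" "self_adjoint T" and z: "z \<in> op_spectrum T"
  shows "cmod z \<le> norm T"
proof (rule ccontr)
  assume "\<not> cmod z \<le> norm T"
  moreover have "(cmod z - norm T) * norm v \<le> norm (T v - z *\<^sub>C v)" for v
    using norm_triangle_ineq3[of "z *\<^sub>C v" "T v"] norm_blinfun[of T v]
    by (simp add: norm_scaleC left_diff_distrib norm_minus_commute)
  ultimately have "bounded_below_on UNIV (\<lambda>v. T v - z *\<^sub>C v)"
    unfolding bounded_below_on_def by (intro exI[of _ "cmod z - norm T"]) auto
  then show False using z op_spectrum_iff_not_bounded_below[OF T] by blast
qed

text \<open>A point of either essential spectrum has a point of the other within \<open>\<epsilon> / 2\<close>. One direction
  moves the infimum and the supremum by little, the other keeps the shrunken gap empty. The bound on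
  the spectrum of \<open>T\<close> is what makes its infimum and supremum meaningful.\<close>

lemma essential_gap_stable:
  fixes S T :: "'a::chilbert_space \<Rightarrow>\<^sub>L 'a"
  assumes S: "complex_linear S" "self_adjoint S" and T: "complex_linear T" "self_adjoint T"
    and near: "norm (T - S) < \<epsilon> / 2" and \<epsilon>: "\<epsilon> < (b - a) / 2" and gap: "essential_gap S a b"
  shows "essential_gap T (a + \<epsilon>) (b - \<epsilon>)"
proof -
  define E where "E R = {r. complex_of_real r \<in> essential_spectrum R}" for R :: "'a \<Rightarrow>\<^sub>L 'a"
  have g: "E S \<noteq> {}" "Inf (E S) \<le> a" "b \<le> Sup (E S)" "{a<..<b} \<inter> E S = {}"
    using gap by (auto simp: essential_gap_def E_def Let_def)
  have near': "norm (S - T) < \<epsilon> / 2" using near by (simp add: norm_minus_commute)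
  have \<epsilon>0: "\<epsilon> > 0" using near norm_ge_zero[of "T - S"] by linarith
  have ST: "\<exists>q\<in>E T. \<bar>q - r\<bar> \<le> \<epsilon> / 2" if "r \<in> E S" for r
    using essential_spectrum_near[OF S T near'] that by (auto simp: E_def)
  have TS: "\<exists>q\<in>E S. \<bar>q - r\<bar> \<le> \<epsilon> / 2" if "r \<in> E T" for r
    using essential_spectrum_near[OF T S near] that by (auto simp: E_def)
  have bound: "\<bar>r\<bar> \<le> norm T" if "r \<in> E T" for r
    using op_spectrum_bounded[OF T, of "complex_of_real r"] that by (simp add: E_def essential_spectrum_def)
  have bdd: "bdd_below (E T)" "bdd_above (E T)"
    using bound by (auto intro!: bdd_belowI[of _ "- norm T"] bdd_aboveI[of _ "norm T"] simp: abs_le_iff)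
      force
  have "Inf (E S) < a + \<epsilon> / 2" using g(2) \<epsilon>0 by simp
  then obtain p where p: "p \<in> E S" "p < a + \<epsilon> / 2" using cInf_lessD[OF g(1)] by blast
  obtain p' where "p' \<in> E T" "\<bar>p' - p\<bar> \<le> \<epsilon> / 2" using ST[OF p(1)] by blast
  with p have p': "p' \<in> E T" "p' \<le> a + \<epsilon>" by linarith+
  then have inf: "Inf (E T) \<le> a + \<epsilon>" using cInf_lower[OF _ bdd(1)] by fastforce
  have "b - \<epsilon> / 2 < Sup (E S)" using g(3) \<epsilon>0 by simp
  then obtain q where q: "q \<in> E S" "b - \<epsilon> / 2 < q" using less_cSupD[OF g(1)] by blast
  obtain q' where "q' \<in> E T" "\<bar>q' - q\<bar> \<le> \<epsilon> / 2" using ST[OF q(1)] by blast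
  with q have q': "q' \<in> E T" "b - \<epsilon> \<le> q'" by linarith+
  then have sup: "b - \<epsilon> \<le> Sup (E T)" using cSup_upper[OF _ bdd(2)] by fastforce
  have "{a + \<epsilon><..<b - \<epsilon>} \<inter> E T = {}"
  proof (rule ccontr)
    assume "\<not> ?thesis"
    then obtain r where r: "r \<in> E T" "a + \<epsilon> < r" "r < b - \<epsilon>" by auto
    obtain s where "s \<in> E S" "\<bar>s - r\<bar> \<le> \<epsilon> / 2" using TS[OF r(1)] by blast
    moreover from this have "a < s" "s < b" using r \<epsilon>0 by linarith+
    ultimately have "s \<in> {a<..<b} \<inter> E S" by simp
    then show False using g(4) by blast
  qed
  then show ?thesis using inf sup p'(1) \<epsilon>
    by (auto simp: essential_gap_def Let_def E_def[symmetric] field_simps)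
qed

lemma holomorphic_family_continuous:
  assumes "holomorphic_family D A" and y: "y \<in> D" and \<eta>: "\<eta> > 0"
  shows "\<exists>\<delta>>0. \<forall>x\<in>D. norm (x - y) < \<delta> \<longrightarrow> norm (A x - A y) < \<eta>"
proof -
  obtain L where L: "((\<lambda>x. norm (A x - A y) / norm (x - y)) \<longlongrightarrow> L) (at y within D)"
    using assms by (auto simp: holomorphic_family_def)
  then obtain \<delta>0 where \<delta>0: "\<delta>0 > 0"
    "\<And>x. x \<in> D \<Longrightarrow> x \<noteq> y \<Longrightarrow> norm (x - y) < \<delta>0 \<Longrightarrow> norm (A x - A y) / norm (x - y) < \<bar>L\<bar> + 1"
    using order_tendstoD(2)[OF L, of "\<bar>L\<bar> + 1"] by (fastforce simp: eventually_at dist_norm)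
  define \<delta> where "\<delta> = min \<delta>0 (\<eta> / (\<bar>L\<bar> + 1))"
  have "norm (A x - A y) < \<eta>" if x: "x \<in> D" "norm (x - y) < \<delta>" for x
  proof (cases "x = y")
    case False
    have "norm (A x - A y) < (\<bar>L\<bar> + 1) * norm (x - y)"
      using \<delta>0(2)[of x] x False by (simp add: \<delta>_def field_simps)
    also have "\<dots> < \<eta>" using x by (simp add: \<delta>_def field_simps)
    finally show ?thesis .
  qed (use \<eta> in simp)
  moreover have "\<delta> > 0" using \<delta>0(1) \<eta> by (simp add: \<delta>_def add_nonneg_pos)
  ultimately show ?thesis by blast
qed

theorem theorem3p4:
  fixes A :: "complex \<Rightarrow> 'a::chilbert_space \<Rightarrow>\<^sub>L 'a"
    and D0 :: "complex set"
    and a b :: real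
  assumes separable: "\<exists>S::'a set. countable S \<and> closure S = UNIV"
    and zero_in: "0 \<in> D0"
    and linear: "\<And>x. x \<in> D0 \<Longrightarrow> complex_linear (A x)"
    and holomorphic: "holomorphic_family D0 A"
    and selfadj: "\<And>x. x \<in> D0 \<Longrightarrow> self_adjoint (A x)"
    and gap: "essential_gap (A 0) a b"
    and no_discrete: "\<And>r. r \<in> {a<..<b} \<Longrightarrow> complex_of_real r \<notin> discrete_spectrum (A 0)"
  shows "\<exists>\<epsilon>0>0. \<forall>\<epsilon>. 0 < \<epsilon> \<and> \<epsilon> < \<epsilon>0 \<longrightarrow>
           (\<exists>\<delta>>0. \<forall>x\<in>D0. norm x < \<delta> \<longrightarrow> essential_gap (A x) (a + \<epsilon>) (b - \<epsilon>))"
proof (rule exI[of _ "(b - a) / 2"], intro conjI allI impI)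
  show "0 < (b - a) / 2" using gap by (simp add: essential_gap_def Let_def)
  fix \<epsilon> assume \<epsilon>: "0 < \<epsilon> \<and> \<epsilon> < (b - a) / 2"
  then obtain \<delta> where "\<delta> > 0" "\<And>x. x \<in> D0 \<Longrightarrow> norm x < \<delta> \<Longrightarrow> norm (A x - A 0) < \<epsilon> / 2"
    using holomorphic_family_continuous[OF holomorphic zero_in, of "\<epsilon> / 2"] by auto
  then show "\<exists>\<delta>>0. \<forall>x\<in>D0. norm x < \<delta> \<longrightarrow> essential_gap (A x) (a + \<epsilon>) (b - \<epsilon>)"
    using essential_gap_stable[OF linear[OF zero_in] selfadj[OF zero_in] linear selfadj _ _ gap] \<epsilon>
    by (intro exI[of _ \<delta>]) auto
qed

end
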